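(* Let $k\in\mathbb{N}$ (with $k\ge1$), let $G=(V,E)$ be a finite weighted graph, and let $s:E^{or}\to S_k^1$ be a signature of $G$. For any function $f:V\to\mathbb{C}$ with $\max_{u\in V}|f(u)|=1$, $$\int_0^1\Big(\iota^s\big(V^f(\sqrt t)\big)+\big|E\big(V^f(\sqrt t),(V^f(\sqrt t))^c\big)\big|\Big)\,dt\;\le\;2\sum_{\{u,v\}\in E}w_{uv}\,|f(u)-s_{uv}f(v)|\cdot\big(|f(u)|+|f(v)|\big),$$ where $V^f(t)=\{u\in V\mid t\le|f(u)|\}$.
   Context: $G=(V,E)$ is a finite simple undirected graph; every edge $\{u,v\}\in E$ carries a positive symmetric weight $w_{uv}=w_{vu}$. $E^{or}=\{(u,v),(v,u)\mid \{u,v\}\in E\}$ is the set of oriented edges. $\Gamma=S_k^1=\{\xi^j\mid 1\le j\le k\}\subset\mathbb{C}$ with $\xi=e^{2\pi i/k}$. A signature is a map $s:E^{or}\to\Gamma$, $s_{uv}:=s((u,v))$, with $s_{vu}=s_{uv}^{-1}$ (so $|f(u)-s_{uv}f(v)|$ does not depend on the orientation of the edge). For nonempty $V_1\subseteq V$ with induced subgraph $(V_1,E_1)$: the frustration index is $\iota^s(V_1)=\min_{\tau:V_1\to\Gamma}\sum_{\{u,v\}\in E_1}w_{uv}|\tau(u)-s_{uv}\tau(v)|$, and $|E(V_1,V_1^c)|=\sum_{u\in V_1}\sum_{v\in V\setminus V_1,\,\{u,v\}\in E}w_{uv}$. *)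

theory Defs
  imports "HOL-Analysis.Analysis" "HOL-Library.FuncSet"
begin

definition finite_simple_graph :: "'a set \<Rightarrow> 'a set set \<Rightarrow> bool" where
  "finite_simple_graph V E \<longleftrightarrow> finite V \<and> (\<forall>e\<in>E. e \<subseteq> V \<and> card e = 2)"

definition edge_weight :: "'a set set \<Rightarrow> ('a \<Rightarrow> 'a \<Rightarrow> real) \<Rightarrow> bool" where
  "edge_weight E w \<longleftrightarrow> (\<forall>u v. {u, v} \<in> E \<longrightarrow> w u v > 0 \<and> w u v = w v u)"

text \<open>Both orientations of an edge are included, because \<open>{u, v} = {v, u}\<close>.\<close>

definition oriented_edges :: "'a set set \<Rightarrow> ('a \<times> 'a) set" where
  "oriented_edges E = {(u, v). {u, v} \<in> E}"

definition cyclic_roots :: "nat \<Rightarrow> complex set" where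
  "cyclic_roots k = {exp (2 * of_real pi * \<i> / of_nat k) ^ j | j. 1 \<le> j \<and> j \<le> k}"

definition signature :: "nat \<Rightarrow> 'a set set \<Rightarrow> ('a \<times> 'a \<Rightarrow> complex) \<Rightarrow> bool" where
  "signature k E s \<longleftrightarrow>
     s \<in> oriented_edges E \<rightarrow> cyclic_roots k \<and>
     (\<forall>u v. (u, v) \<in> oriented_edges E \<longrightarrow> s (v, u) = inverse (s (u, v)))"

text \<open>
  Each unordered edge is counted once. The summand \<open>g u v\<close> has to be independent of the
  orientation of the edge; see \<open>edge_value_eq\<close>, and \<open>signed_difference_commute\<close> for the
  summands used below.
\<close>

definition edge_value :: "('a \<Rightarrow> 'a \<Rightarrow> real) \<Rightarrow> 'a set \<Rightarrow> real" where
  "edge_value g e = (THE x. \<exists>u v. e = {u, v} \<and> x = g u v)"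

definition edge_sum :: "'a set set \<Rightarrow> ('a \<Rightarrow> 'a \<Rightarrow> real) \<Rightarrow> real" where
  "edge_sum E g = (\<Sum>e\<in>E. edge_value g e)"

definition induced_edges :: "'a set set \<Rightarrow> 'a set \<Rightarrow> 'a set set" where
  "induced_edges E V1 = {e \<in> E. e \<subseteq> V1}"

text \<open>
  The minimum is over all maps from \<open>V1\<close> to the \<open>k\<close>-th roots of unity; using extensional
  functions makes this a finite set.
\<close>

definition frustration_index ::
    "nat \<Rightarrow> 'a set set \<Rightarrow> ('a \<Rightarrow> 'a \<Rightarrow> real) \<Rightarrow> ('a \<times> 'a \<Rightarrow> complex) \<Rightarrow> 'a set \<Rightarrow> real" where
  "frustration_index k E w s V1 =
     Min ((\<lambda>\<tau>. edge_sum (induced_edges E V1) (\<lambda>u v. w u v * cmod (\<tau> u - s (u, v) * \<tau> v)))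
          ` (V1 \<rightarrow>\<^sub>E cyclic_roots k))"

definition boundary_weight ::
    "'a set \<Rightarrow> 'a set set \<Rightarrow> ('a \<Rightarrow> 'a \<Rightarrow> real) \<Rightarrow> 'a set \<Rightarrow> real" where
  "boundary_weight V E w V1 = (\<Sum>u\<in>V1. \<Sum>v\<in>{v \<in> V - V1. {u, v} \<in> E}. w u v)"

definition superlevel_set :: "'a set \<Rightarrow> ('a \<Rightarrow> complex) \<Rightarrow> real \<Rightarrow> 'a set" where
  "superlevel_set V f t = {u \<in> V. t \<le> cmod (f u)}"

lemma edge_value_eq:
  assumes "g u v = g v u"
  shows "edge_value g {u, v} = g u v"
  unfolding edge_value_def
  by (rule the_equality) (use assms in \<open>auto simp: doubleton_eq_iff\<close>)

lemma norm_cyclic_roots: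
  assumes "z \<in> cyclic_roots k"
  shows "cmod z = 1"
proof -
  have "cmod (exp (2 * of_real pi * \<i> / of_nat k)) = 1"
    by (simp add: norm_exp_eq_Re)
  then show ?thesis
    using assms by (auto simp: cyclic_roots_def norm_power)
qed

lemma signed_difference_commute:
  fixes f :: "'a \<Rightarrow> complex"
  assumes "signature k E s" "{u, v} \<in> E"
  shows "cmod (f u - s (u, v) * f v) = cmod (f v - s (v, u) * f u)"
proof -
  have root: "s (u, v) \<in> cyclic_roots k" and inv: "s (v, u) = inverse (s (u, v))"
    using assms by (auto simp: signature_def oriented_edges_def)
  have norm: "cmod (s (u, v)) = 1"
    using root by (rule norm_cyclic_roots)
  then have "s (u, v) \<noteq> 0" by auto
  then have "f u - s (u, v) * f v = - s (u, v) * (f v - s (v, u) * f u)"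
    by (simp add: inv algebra_simps)
  then have "cmod (f u - s (u, v) * f v) = cmod (- s (u, v) * (f v - s (v, u) * f u))"
    by (rule arg_cong)
  also have "\<dots> = cmod (f v - s (v, u) * f u)"
    using norm by (simp add: norm_mult)
  finally show ?thesis .
qed

end

theory Submission
  imports Defs
begin

text \<open>
  Write \<open>f u = |f u| \<cdot> phase k (a u)\<close> with \<open>phase k y = exp (2 \<pi> i y / k)\<close>, and round every phase
  to a \<open>k\<close>-th root of unity by \<open>\<tau>\<^sub>x u = phase k \<lfloor>a u + x\<rfloor>\<close>. Averaged over the offset \<open>x \<in> [0, 1]\<close>,
  the distance of two rounded phases is the piecewise linear interpolation, at the integers, of
  the chord length \<open>y \<mapsto> 2 sin (\<pi> y / k)\<close>, so by concavity it is at most the distance of the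
  original phases. Hence the frustration index of a vertex set is at most the sum of
  \<open>w |phase k (a u) - s phase k (a v)|\<close> over its induced edges. It remains to integrate over the
  threshold \<open>t\<close> edge by edge: an edge with \<open>|f v| \<le> |f u|\<close> is induced for \<open>t \<le> |f v|\<^sup>2\<close> and cut
  for \<open>|f v|\<^sup>2 < t \<le> |f u|\<^sup>2\<close>.
\<close>

section \<open>Integrals of threshold and shifted floor functions\<close>

lemma has_integral_threshold:
  fixes c :: real
  assumes "0 \<le> c" "c \<le> 1"
  shows "((\<lambda>t. if t \<le> c then 1 else 0) has_integral c) {0..1::real}"
proof -
  have "((\<lambda>t. 1::real) has_integral c) {0..c}"
    using has_integral_const_real[of "1::real" 0 c] assms by simp
  then have "((\<lambda>t. if t \<in> {0..c} then 1 else 0::real) has_integral c) {0..1}"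
    using assms by (subst has_integral_restrict) auto
  then show ?thesis
    by (rule has_integral_eq[rotated]) auto
qed

text \<open>Rounding down after a uniform offset is unbiased: on the unit interval the floor jumps
  once, at \<open>1 - frac c\<close>, and so equals \<open>floor c + 1\<close> for a proportion
  \<open>frac c\<close> of the offsets.\<close>

lemma has_integral_floor_shift:
  "((\<lambda>x. of_int \<lfloor>c + x\<rfloor>) has_integral c) {0..1::real}"
proof -
  define q where "q = 1 - frac c"
  have q: "0 \<le> q" "q \<le> 1"
    using frac_lt_1[of c] frac_ge_0[of c] by (auto simp: q_def)
  have "((\<lambda>x. (of_int \<lfloor>c\<rfloor> + 1) - (if x \<le> q then 1 else 0)) has_integral
      (of_int \<lfloor>c\<rfloor> + 1) - q) {0..1::real}"
    using has_integral_diff[OF has_integral_const_real[of "of_int \<lfloor>c\<rfloor> + 1" 0 1]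
        has_integral_threshold[OF q]] by simp
  also have "(of_int \<lfloor>c\<rfloor> + 1) - q = c"
    by (simp add: q_def frac_def)
  finally show ?thesis
  proof (rule has_integral_spike_finite[rotated 2])
    \<comment> \<open>At \<open>x = q\<close> the floor has already jumped while
      \<open>x \<le> q\<close> still holds, so the two functions agree only up to a finite
      set.\<close>
    show "finite {q, 1}" by simp
    fix x :: real assume x: "x \<in> {0..1} - {q, 1}"
    show "of_int \<lfloor>c + x\<rfloor> = of_int \<lfloor>c\<rfloor> + 1 - (if x \<le> q then 1 else 0 :: real)"
    proof (cases "x \<le> q")
      case True
      with x have "\<lfloor>c + x\<rfloor> = \<lfloor>c\<rfloor>"
        unfolding q_def frac_def by auto linarith
      with True show ?thesis by simp
    next
      case False
      with x have "\<lfloor>c + x\<rfloor> = \<lfloor>c\<rfloor> + 1"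
        unfolding q_def frac_def by auto linarith
      with False show ?thesis by simp
    qed
  qed
qed

section \<open>Phases and roots of unity\<close>

definition phase :: "nat \<Rightarrow> real \<Rightarrow> complex" where
  "phase k y = cis (2 * pi * y / real k)"

lemma phase_add: "phase k (x + y) = phase k x * phase k y"
  by (simp add: phase_def cis_mult distrib_left add_divide_distrib)

lemma norm_phase [simp]: "cmod (phase k y) = 1"
  by (simp add: phase_def)

text \<open>Factoring out \<open>phase k y\<close> leaves a chord of the unit circle with half angle
  \<open>a\<close>. The bounds on \<open>x - y\<close> put \<open>a\<close> between 0 and
  \<open>pi\<close>, where the sine needs no absolute value.\<close>

lemma phase_diff_norm:
  assumes "0 \<le> x - y" "x - y \<le> real k" "k \<ge> 1"
  shows "cmod (phase k x - phase k y) = 2 * sin (pi * (x - y) / real k)"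
proof -
  define a where "a = pi * (x - y) / real k"
  have "phase k x = phase k y * cis (2 * a)"
    unfolding phase_def a_def cis_mult using assms by (simp add: field_simps)
  then have "cmod (phase k x - phase k y) = cmod (phase k y * (cis (2 * a) - 1))"
    by (simp add: algebra_simps)
  also have "\<dots> = cmod (cis (2 * a) - 1)"
    by (simp add: norm_mult)
  also have "\<dots> = 2 * \<bar>sin a\<bar>"
    using dist_exp_i_1[of "2 * a"] by (simp add: cis_conv_exp)
  also have "\<bar>sin a\<bar> = sin a"
    using assms by (intro abs_of_nonneg sin_ge_zero) (auto simp: a_def divide_simps mult_left_mono)
  finally show ?thesis by (simp add: a_def)
qed

lemma phase_period:
  assumes "k \<ge> 1"
  shows "phase k (y + real k * of_int m) = phase k y"
proof -
  have "2 * pi * (real k * of_int m) / real k = 2 * pi * of_int m"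
    using assms by simp
  then have "phase k (real k * of_int m) = cis (2 * pi * of_int m)"
    unfolding phase_def by (rule arg_cong)
  also have "\<dots> = 1"
    by (rule cis_multiple_2pi) simp
  finally show ?thesis
    by (simp add: phase_add)
qed

text \<open>Phases are measured in units of one k-th of a turn, so the roots are exactly the integer
  phases and taking the floor rounds a phase to a root.\<close>

lemma cyclic_roots_eq:
  assumes "k \<ge> 1"
  shows "cyclic_roots k = range (\<lambda>m::int. phase k (of_int m))"
proof -
  have pw: "exp (2 * of_real pi * \<i> / of_nat k) ^ j = phase k (real j)" for j
    unfolding phase_def cis_conv_exp exp_of_nat_mult[symmetric] by (simp add: field_simps)
  have "phase k (of_int m) \<in> cyclic_roots k" for m :: int
  proof -
    \<comment> \<open>The exponents in \<open>cyclic_roots\<close> run from 1 to \<open>k\<close>,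
      so residue 0 is represented by \<open>k\<close>.\<close>
    define j where "j = nat (m mod int k) + (if m mod int k = 0 then k else 0)"
    have mod: "0 \<le> m mod int k" "m mod int k < int k"
      using assms by auto
    then have "int j = m + int k * (- (m div int k) + (if m mod int k = 0 then 1 else 0))"
      using mult_div_mod_eq[of "int k" m] by (auto simp: j_def algebra_simps)
    then have "real j = of_int m + real k * of_int (- (m div int k) + (if m mod int k = 0 then 1 else 0))"
      by (metis of_int_add of_int_mult of_int_of_nat_eq)
    then have "phase k (real j) = phase k (of_int m)"
      using phase_period[OF assms] by metis
    moreover have "1 \<le> j" "j \<le> k"
      using mod assms unfolding j_def by (cases "m mod int k = 0"; simp; linarith)+
    ultimately show ?thesis
      unfolding cyclic_roots_def pw by (auto intro!: exI[of _ j])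
  qed
  moreover have "phase k (real j) \<in> range (\<lambda>m::int. phase k (of_int m))" for j
    by (rule image_eqI[of _ _ "int j"]) auto
  ultimately show ?thesis
    unfolding cyclic_roots_def pw by (auto simp: pw cyclic_roots_def)
qed

lemma finite_cyclic_roots: "finite (cyclic_roots k)"
proof -
  have "cyclic_roots k = (\<lambda>j. exp (2 * of_real pi * \<i> / of_nat k) ^ j) ` {1..k}"
    by (auto simp: cyclic_roots_def)
  then show ?thesis by simp
qed

section \<open>Averaged rounding of a pair of phases\<close>

lemma concave_on_sin: "concave_on {0..pi} sin"
  by (rule f''_le0_imp_concave[where f' = cos and f'' = "\<lambda>x. - sin x"])
    (auto intro!: derivative_eq_intros sin_ge_zero)

text \<open>Both phases are rounded with the same offset, which keeps the difference of the floors
  next to the true difference. The existential supplies integrability together with the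
  bound.\<close>

lemma has_integral_rounded_phase_diff:
  assumes k: "k \<ge> 1"
  shows "\<exists>I. ((\<lambda>x. cmod (phase k (of_int \<lfloor>a + x\<rfloor>) - phase k (of_int \<lfloor>b + x\<rfloor>))) has_integral I) {0..1}
    \<and> I \<le> cmod (phase k a - phase k b)"
proof -
  \<comment> \<open>a representative of \<open>a\<close> modulo \<open>k\<close> with \<open>0 \<le> c - b < k\<close>\<close>
  define c where "c = a + real k * of_int (- \<lfloor>(a - b) / real k\<rfloor>)"
  define m where "m = \<lfloor>c - b\<rfloor>"
  have c_round: "phase k (of_int \<lfloor>a + x\<rfloor>) = phase k (of_int \<lfloor>c + x\<rfloor>)" for x
  proof -
    have "c + x = (a + x) + of_int (int k * (- \<lfloor>(a - b) / real k\<rfloor>))"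
      by (simp add: c_def)
    then have "real_of_int \<lfloor>c + x\<rfloor> = of_int \<lfloor>a + x\<rfloor> + real k * of_int (- \<lfloor>(a - b) / real k\<rfloor>)"
      by (simp only: floor_add_int[symmetric]) simp
    then show ?thesis using phase_period[OF k] by metis
  qed
  have c_phase: "phase k c = phase k a"
    unfolding c_def by (rule phase_period[OF k])
  have "c - b = real k * frac ((a - b) / real k)"
    using k by (simp add: c_def frac_def field_simps)
  then have cb: "0 \<le> c - b" "c - b < real k"
    using k frac_lt_1[of "(a - b) / real k"] frac_ge_0[of "(a - b) / real k"]
    by (auto simp: mult_less_cancel_left1)
  then have m: "0 \<le> m" "m < int k"
    by (auto simp: m_def floor_less_iff)
  \<comment> \<open>This keeps the upper node \<open>m + 1\<close> in the range of the chord formula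
    and \<open>pi * (m + 1) / k\<close> in the interval of concavity.\<close>
  then have mk: "real_of_int m + 1 \<le> real k"
    by linarith
  define h where "h y = 2 * sin (pi * y / real k)" for y
  \<comment> \<open>The difference of the two floors only takes the values \<open>m\<close> and \<open>m + 1\<close>, so the integrand is
    an affine function of it.\<close>
  have val: "cmod (phase k (of_int \<lfloor>a + x\<rfloor>) - phase k (of_int \<lfloor>b + x\<rfloor>))
    = h m + (of_int \<lfloor>c + x\<rfloor> - of_int \<lfloor>b + x\<rfloor> - m) * (h (m + 1) - h m)" for x
  proof -
    have "\<lfloor>c + x\<rfloor> - \<lfloor>b + x\<rfloor> = m \<or> \<lfloor>c + x\<rfloor> - \<lfloor>b + x\<rfloor> = m + 1"
      unfolding m_def by linarith
    then have D: "real_of_int \<lfloor>c + x\<rfloor> - of_int \<lfloor>b + x\<rfloor> = m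
       \<or> real_of_int \<lfloor>c + x\<rfloor> - of_int \<lfloor>b + x\<rfloor> = m + 1"
      by linarith
    have "cmod (phase k (of_int \<lfloor>a + x\<rfloor>) - phase k (of_int \<lfloor>b + x\<rfloor>))
       = h (of_int \<lfloor>c + x\<rfloor> - of_int \<lfloor>b + x\<rfloor>)"
      unfolding c_round h_def using D m mk k by (intro phase_diff_norm) auto
    with D show ?thesis by auto
  qed
  \<comment> \<open>The affine expression with the two floors replaced by their means
    \<open>c\<close> and \<open>b\<close>.\<close>
  define I where "I = h m + (c - b - m) * (h (m + 1) - h m)"
  have "((\<lambda>x. h m + (of_int \<lfloor>c + x\<rfloor> - of_int \<lfloor>b + x\<rfloor> - m) * (h (m + 1) - h m))
     has_integral I) {0..1}"
    unfolding I_def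
    using has_integral_add[OF has_integral_const_real[of "h m" 0 1]
      has_integral_mult_left[OF has_integral_diff[OF has_integral_diff[OF
        has_integral_floor_shift[of c] has_integral_floor_shift[of b]]
        has_integral_const_real[of "real_of_int m" 0 1]], of "h (m + 1) - h m"]]
    by simp
  moreover have "I \<le> cmod (phase k a - phase k b)"
  proof -
    \<comment> \<open>\<open>p\<close> is the weight of the node \<open>m + 1\<close> in the
      interpolation, so concavity bounds \<open>I\<close> by the chord at
      \<open>m + p = c - b\<close>.\<close>
    define p where "p = c - b - m"
    have p: "0 \<le> p" "p \<le> 1"
      unfolding p_def m_def by linarith+
    have "(1 - p) * sin (pi * m / k) + p * sin (pi * (m + 1) / k)
        \<le> sin ((1 - p) *\<^sub>R (pi * m / k) + p *\<^sub>R (pi * (m + 1) / k))"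
      using m mk k p by (intro concave_onD[OF concave_on_sin]) (auto simp: divide_simps mult_left_mono)
    also have "(1 - p) *\<^sub>R (pi * m / k) + p *\<^sub>R (pi * (m + 1) / k) = pi * (m + p) / k"
      using k by (simp add: field_simps)
    also have "m + p = c - b" by (simp add: p_def)
    finally have "I \<le> h (c - b)"
      unfolding I_def h_def p_def[symmetric] by (simp add: algebra_simps)
    also have "\<dots> = cmod (phase k a - phase k b)"
      unfolding c_phase[symmetric] h_def using cb k by (intro phase_diff_norm[symmetric]) auto
    finally show ?thesis .
  qed
  ultimately show ?thesis unfolding val by blast
qed

section \<open>The inequality for a single edge\<close>

text \<open>Geometrically, \<open>r' P\<close> is the nearest point to \<open>r P\<close> in the
  disc of radius \<open>r'\<close>, and projecting onto the disc does not increase the distance to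
  its point \<open>r' Q\<close>. The proof compares squares, whose difference factors into
  nonnegative terms.\<close>

lemma shorter_norm_mult_dist_le:
  fixes P Q :: complex
  assumes "cmod P = 1" "cmod Q = 1" "0 \<le> r'" "r' \<le> r"
  shows "r' * cmod (P - Q) \<le> cmod (of_real r * P - of_real r' * Q)"
proof (rule power2_le_imp_le)
  have n: "P \<bullet> P = 1" "Q \<bullet> Q = 1"
    using assms by (simp_all add: dot_square_norm)
  have pq: "P \<bullet> Q \<le> 1"
    using norm_cauchy_schwarz[of P Q] assms by simp
  have "(cmod (of_real r * P - of_real r' * Q))\<^sup>2 = r\<^sup>2 + r'\<^sup>2 - 2 * r * r' * (P \<bullet> Q)"
    unfolding scaleR_conv_of_real[symmetric] power2_norm_eq_inner
    by (simp add: inner_diff n inner_commute power2_eq_square algebra_simps)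
  moreover have "(r' * cmod (P - Q))\<^sup>2 = r'\<^sup>2 * (2 - 2 * (P \<bullet> Q))"
    unfolding power_mult_distrib power2_norm_eq_inner
    by (simp add: inner_diff n inner_commute)
  moreover have "r\<^sup>2 + r'\<^sup>2 - 2 * r * r' * (P \<bullet> Q) - r'\<^sup>2 * (2 - 2 * (P \<bullet> Q))
     = (r - r') * ((r - r') + 2 * r' * (1 - P \<bullet> Q))"
    by (simp add: power2_eq_square algebra_simps)
  moreover have "(r - r') * ((r - r') + 2 * r' * (1 - P \<bullet> Q)) \<ge> 0"
    using assms pq by (intro mult_nonneg_nonneg add_nonneg_nonneg) auto
  ultimately show "(r' * cmod (P - Q))\<^sup>2 \<le> (cmod (of_real r * P - of_real r' * Q))\<^sup>2"
    by linarith
qed simp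

text \<open>The coefficients are the lengths of the threshold intervals on which the edge is induced
  and cut, respectively. Each summand is at most \<open>d * (r + r')\<close>, which explains the
  factor 2.\<close>

lemma edge_layer_bound:
  fixes P Q :: complex
  assumes "cmod P = 1" "cmod Q = 1" "0 \<le> r'" "r' \<le> r"
  shows "r'\<^sup>2 * cmod (P - Q) + (r\<^sup>2 - r'\<^sup>2) \<le> 2 * (cmod (of_real r * P - of_real r' * Q) * (r + r'))"
proof -
  define d where "d = cmod (of_real r * P - of_real r' * Q)"
  have "r'\<^sup>2 * cmod (P - Q) \<le> r' * d"
    using mult_left_mono[OF shorter_norm_mult_dist_le[OF assms] assms(3)]
    by (simp add: d_def power2_eq_square mult.assoc)
  also have "\<dots> \<le> d * (r + r')"
    using assms mult_right_mono[of r' "r + r'" d] by (simp add: d_def mult.commute)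
  finally have "r'\<^sup>2 * cmod (P - Q) \<le> d * (r + r')" .
  moreover have "r - r' \<le> d"
    unfolding d_def using norm_triangle_ineq2[of "of_real r * P" "of_real r' * Q"] assms
    by (simp add: norm_mult)
  then have "(r - r') * (r + r') \<le> d * (r + r')"
    using assms by (intro mult_right_mono) auto
  moreover have "r\<^sup>2 - r'\<^sup>2 = (r - r') * (r + r')"
    by (simp add: power2_eq_square algebra_simps)
  ultimately show ?thesis
    unfolding d_def[symmetric] by linarith
qed

section \<open>Frustration index and boundary weight as sums over edges\<close>

lemma edge_endpointsE:
  assumes "finite_simple_graph V E" "e \<in> E"
  obtains u v where "e = {u, v}" "u \<in> V" "v \<in> V"
proof -
  have "e \<subseteq> V" "card e = 2"
    using assms by (auto simp: finite_simple_graph_def)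
  then show ?thesis
    using that by (auto simp: card_2_iff)
qed

lemma finite_edges:
  assumes "finite_simple_graph V E"
  shows "finite E"
proof (rule finite_subset)
  show "E \<subseteq> Pow V" "finite (Pow V)"
    using assms by (auto simp: finite_simple_graph_def)
qed

lemma edge_value_signed_difference:
  assumes "edge_weight E w" "signature k E s" "{u, v} \<in> E"
  shows "edge_value (\<lambda>u v. w u v * cmod (g u - s (u, v) * g v)) {u, v}
    = w u v * cmod (g u - s (u, v) * g v)"
  using assms signed_difference_commute[OF assms(2,3), of g]
  by (intro edge_value_eq) (auto simp: edge_weight_def)

text \<open>The minimum is below the value of every rounded labelling, hence below their average
  over the offset; by linearity the average can be bounded edge by edge.\<close>

lemma frustration_index_le:
  assumes "k \<ge> 1" "finite_simple_graph V E" "edge_weight E w" "signature k E s" "W \<subseteq> V"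
  shows "frustration_index k E w s W
    \<le> edge_sum (induced_edges E W) (\<lambda>u v. w u v * cmod (phase k (a u) - s (u, v) * phase k (a v)))"
proof -
  define g where "g \<tau> = (\<lambda>u v. w u v * cmod (\<tau> u - s (u, v) * \<tau> v))" for \<tau>
  \<comment> \<open>The restriction makes the labelling extensional, as the minimum in
    \<open>frustration_index\<close> requires.\<close>
  define \<tau> where "\<tau> x = restrict (\<lambda>u. phase k (of_int \<lfloor>a u + x\<rfloor>)) W" for x
  have finV: "finite W" and finE: "finite (induced_edges E W)"
    using assms finite_edges[of V E]
    by (auto simp: finite_simple_graph_def induced_edges_def intro: finite_subset)
  have le: "frustration_index k E w s W \<le> edge_sum (induced_edges E W) (g (\<tau> x))" for x
    unfolding frustration_index_def g_def
  proof (intro Min_le finite_imageI finite_PiE finV finite_cyclic_roots imageI)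
    show "\<tau> x \<in> W \<rightarrow>\<^sub>E cyclic_roots k"
      using cyclic_roots_eq[OF \<open>k \<ge> 1\<close>] by (auto simp: \<tau>_def)
  qed
  have "\<exists>I. ((\<lambda>x. edge_value (g (\<tau> x)) e) has_integral I) {0..1}
      \<and> I \<le> edge_value (g (\<lambda>u. phase k (a u))) e" if "e \<in> induced_edges E W" for e
  proof -
    have e: "e \<in> E" "e \<subseteq> W"
      using that by (auto simp: induced_edges_def)
    obtain u v where uv: "e = {u, v}"
      using edge_endpointsE[OF assms(2) e(1)] by metis
    have "s (u, v) \<in> cyclic_roots k"
      using assms(4) e uv by (auto simp: signature_def oriented_edges_def)
    then obtain m :: int where m: "s (u, v) = phase k (of_int m)"
      using cyclic_roots_eq[OF \<open>k \<ge> 1\<close>] by auto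
    have wp: "w u v \<ge> 0"
      using assms(3) e uv by (auto simp: edge_weight_def less_imp_le)
    have val: "edge_value (g p) e = w u v * cmod (p u - s (u, v) * p v)" for p
      unfolding g_def uv using assms e uv by (intro edge_value_signed_difference) auto
    \<comment> \<open>Multiplying by a root adds an integer to the phase, which passes through the
      floor; so the signature is absorbed into the second phase before rounding.\<close>
    have shift: "s (u, v) * phase k (of_int \<lfloor>a v + x\<rfloor>) = phase k (of_int \<lfloor>(m + a v) + x\<rfloor>)" for x
      unfolding m phase_add[symmetric] by (simp add: add.assoc)
    obtain I where I: "((\<lambda>x. cmod (phase k (of_int \<lfloor>a u + x\<rfloor>) - phase k (of_int \<lfloor>(m + a v) + x\<rfloor>)))
        has_integral I) {0..1}" "I \<le> cmod (phase k (a u) - phase k (m + a v))"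
      using has_integral_rounded_phase_diff[OF \<open>k \<ge> 1\<close>] by metis
    have "((\<lambda>x. edge_value (g (\<tau> x)) e) has_integral w u v * I) {0..1}"
      unfolding val using has_integral_mult_right[OF I(1)] e uv by (simp add: \<tau>_def shift)
    moreover have "w u v * I \<le> edge_value (g (\<lambda>u. phase k (a u))) e"
      unfolding val m phase_add[symmetric] by (intro mult_left_mono I(2) wp)
    ultimately show ?thesis by blast
  qed
  then obtain I where I: "\<And>e. e \<in> induced_edges E W \<Longrightarrow>
        ((\<lambda>x. edge_value (g (\<tau> x)) e) has_integral I e) {0..1}"
      "\<And>e. e \<in> induced_edges E W \<Longrightarrow> I e \<le> edge_value (g (\<lambda>u. phase k (a u))) e"
    by metis
  have "((\<lambda>x. edge_sum (induced_edges E W) (g (\<tau> x))) has_integral sum I (induced_edges E W)) {0..1}"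
    unfolding edge_sum_def by (intro has_integral_sum finE I(1))
  then have "frustration_index k E w s W \<le> sum I (induced_edges E W)"
    using has_integral_le[OF has_integral_const_real[of "frustration_index k E w s W" 0 1]] le by simp
  also have "\<dots> \<le> edge_sum (induced_edges E W) (g (\<lambda>u. phase k (a u)))"
    unfolding edge_sum_def by (intro sum_mono I(2))
  finally show ?thesis by (simp add: g_def)
qed

text \<open>A cut edge has a unique orientation leaving \<open>W\<close>, so the double sum meets it
  once. In this form the boundary weight can be added to the frustration bound edge by edge.\<close>

lemma boundary_weight_eq:
  assumes "finite_simple_graph V E" "edge_weight E w" "W \<subseteq> V"
  shows "boundary_weight V E w W
    = (\<Sum>e\<in>E. if e \<inter> W \<noteq> {} \<and> \<not> e \<subseteq> W then edge_value w e else 0)"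
proof -
  define A where "A = (SIGMA u:W. {v \<in> V - W. {u, v} \<in> E})"
  have fin: "finite V" "finite W"
    using assms by (auto simp: finite_simple_graph_def intro: finite_subset)
  have "boundary_weight V E w W = (\<Sum>(u, v)\<in>A. w u v)"
    unfolding boundary_weight_def A_def using fin by (intro sum.Sigma) auto
  also have "\<dots> = (\<Sum>p\<in>A. edge_value w ((\<lambda>(u, v). {u, v}) p))"
  proof (intro sum.cong refl)
    fix p assume "p \<in> A"
    then obtain u v where p: "p = (u, v)" "{u, v} \<in> E"
      by (auto simp: A_def)
    then have "edge_value w {u, v} = w u v"
      using assms(2) by (intro edge_value_eq) (auto simp: edge_weight_def)
    with p show "(case p of (u, v) \<Rightarrow> w u v) = edge_value w ((\<lambda>(u, v). {u, v}) p)"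
      by simp
  qed
  also have "\<dots> = (\<Sum>e\<in>(\<lambda>(u, v). {u, v}) ` A. edge_value w e)"
  proof -
    have "inj_on (\<lambda>(u, v). {u, v}) A"
      by (rule inj_onI) (auto simp: A_def doubleton_eq_iff)
    from sum.reindex[OF this, of "edge_value w"] show ?thesis
      by (simp only: o_def)
  qed
  also have "(\<lambda>(u, v). {u, v}) ` A = {e \<in> E. e \<inter> W \<noteq> {} \<and> \<not> e \<subseteq> W}"
  proof (intro equalityI subsetI)
    fix e assume e: "e \<in> {e \<in> E. e \<inter> W \<noteq> {} \<and> \<not> e \<subseteq> W}"
    then obtain u v where "e = {u, v}" "u \<in> V" "v \<in> V"
      using edge_endpointsE[OF assms(1)] by (metis (no_types, lifting) mem_Collect_eq)
    moreover have "{v, u} = {u, v}"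
      by blast
    ultimately have "(u, v) \<in> A \<or> (v, u) \<in> A"
      using e by (auto simp: A_def)
    then show "e \<in> (\<lambda>(u, v). {u, v}) ` A"
      using \<open>e = {u, v}\<close> \<open>{v, u} = {u, v}\<close> by (metis (no_types, lifting) case_prod_conv image_eqI)
  qed (auto simp: A_def)
  also have "(\<Sum>e\<in>\<dots>. edge_value w e)
      = (\<Sum>e\<in>E. if e \<inter> W \<noteq> {} \<and> \<not> e \<subseteq> W then edge_value w e else 0)"
    using finite_edges[OF assms(1)] by (intro sum.inter_filter) auto
  finally show ?thesis .
qed

section \<open>Integration over the threshold\<close>

lemma integrable_on_superlevel:
  fixes G :: "'a set \<Rightarrow> real"
  assumes "finite V"
  shows "(\<lambda>t. G (superlevel_set V f (sqrt t))) integrable_on {0..1}"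
proof -
  \<comment> \<open>The superlevel sets shrink as \<open>t\<close> grows, so each \<open>S W\<close>
    is an interval; there are finitely many \<open>W\<close>, so the integrand is a step function
    whatever \<open>G\<close> is.\<close>
  define S where "S W = {t \<in> {0..1}. superlevel_set V f (sqrt t) = W}" for W
  have "S W \<in> lmeasurable" for W
  proof (rule measurable_convex)
    show "bounded (S W)"
      by (rule bounded_subset[of "{0..1}"]) (auto simp: S_def)
    have anti: "superlevel_set V f (sqrt y) \<subseteq> superlevel_set V f (sqrt x)" if "x \<le> y" for x y
      using that by (auto simp: superlevel_set_def intro: order_trans[OF real_sqrt_le_mono])
    have "y \<in> S W" if "x \<in> S W" "z \<in> S W" "x \<le> y" "y \<le> z" for x y z
      using that anti[of x y] anti[of y z] unfolding S_def by auto
    then show "convex (S W)"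
      unfolding is_interval_convex_1[symmetric] is_interval_1 by blast
  qed
  moreover have "S W \<inter> {0..1} = S W" for W
    by (auto simp: S_def)
  ultimately have "(\<lambda>t. \<Sum>W\<in>Pow V. G W * indicat_real (S W) t) integrable_on {0..1}"
    using assms by (intro integrable_sum integrable_on_mult_right) (auto simp: integrable_on_indicator)
  then show ?thesis
  proof (rule integrable_eq)
    fix t :: real assume t: "t \<in> {0..1}"
    have "(\<Sum>W\<in>Pow V. G W * indicat_real (S W) t)
        = (\<Sum>W\<in>Pow V. if W = superlevel_set V f (sqrt t) then G W else 0)"
      using t by (intro sum.cong) (auto simp: S_def indicator_def)
    also have "\<dots> = G (superlevel_set V f (sqrt t))"
      using assms by (subst sum.delta) (auto simp: superlevel_set_def)
    finally show "(\<Sum>W\<in>Pow V. G W * indicat_real (S W) t) = G (superlevel_set V f (sqrt t))" .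
  qed
qed

lemma has_integral_edge_layers:
  assumes "0 \<le> r'" "r' \<le> r" "r \<le> 1"
  shows "((\<lambda>t. if sqrt t \<le> r' then A else if sqrt t \<le> r then B else 0)
      has_integral (r'\<^sup>2 * A + (r\<^sup>2 - r'\<^sup>2) * B)) {0..1::real}"
proof -
  have b: "0 \<le> r'\<^sup>2" "r'\<^sup>2 \<le> 1" "0 \<le> r\<^sup>2" "r\<^sup>2 \<le> 1"
    using assms by (auto simp: power_le_one)
  \<comment> \<open>Two nested thresholds: below the smaller one the contributions
    \<open>A - B\<close> and \<open>B\<close> add up to \<open>A\<close>.\<close>
  have "((\<lambda>t. (if t \<le> r'\<^sup>2 then 1 else 0) * (A - B) + (if t \<le> r\<^sup>2 then 1 else 0) * B)
      has_integral (r'\<^sup>2 * (A - B) + r\<^sup>2 * B)) {0..1}"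
    using b by (intro has_integral_add has_integral_mult_left has_integral_threshold)
  also have "r'\<^sup>2 * (A - B) + r\<^sup>2 * B = r'\<^sup>2 * A + (r\<^sup>2 - r'\<^sup>2) * B"
    by (simp add: algebra_simps)
  finally show ?thesis
  proof (rule has_integral_eq[rotated])
    fix t :: real assume "t \<in> {0..1}"
    then have "sqrt t \<le> q \<longleftrightarrow> t \<le> q\<^sup>2" if "0 \<le> q" for q
      using that by (metis abs_of_nonneg real_sqrt_abs real_sqrt_le_iff)
    moreover have "t \<le> r\<^sup>2" if "t \<le> r'\<^sup>2"
      using that assms power_mono[of r' r 2] by linarith
    ultimately show "(if t \<le> r'\<^sup>2 then 1 else 0) * (A - B) + (if t \<le> r\<^sup>2 then 1 else 0) * B
        = (if sqrt t \<le> r' then A else if sqrt t \<le> r then B else 0)"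
      using assms by simp
  qed
qed

section \<open>Assembling the estimate over all edges\<close>

theorem lemma4p3:
  fixes k :: nat and V :: "'a set" and E :: "'a set set"
    and w :: "'a \<Rightarrow> 'a \<Rightarrow> real" and s :: "'a \<times> 'a \<Rightarrow> complex" and f :: "'a \<Rightarrow> complex"
  assumes "k \<ge> 1"
    and "finite_simple_graph V E"
    and "V \<noteq> {}"
    and "edge_weight E w"
    and "signature k E s"
    and "Max ((\<lambda>u. cmod (f u)) ` V) = 1"
  shows "(\<lambda>t. frustration_index k E w s (superlevel_set V f (sqrt t))
              + boundary_weight V E w (superlevel_set V f (sqrt t))) integrable_on {0..1}
       \<and> integral {0..1} (\<lambda>t. frustration_index k E w s (superlevel_set V f (sqrt t))
              + boundary_weight V E w (superlevel_set V f (sqrt t)))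
         \<le> 2 * edge_sum E (\<lambda>u v. w u v * cmod (f u - s (u, v) * f v) * (cmod (f u) + cmod (f v)))"
proof -
  define W where "W t = superlevel_set V f (sqrt t)" for t
  \<comment> \<open>Scaled so that \<open>phase k (a u)\<close> is the direction of
    \<open>f u\<close>. Where \<open>f u = 0\<close> the direction is a default value, and
    \<open>f_eq\<close> below still holds because the modulus vanishes.\<close>
  define a where "a u = real k * Arg (f u) / (2 * pi)" for u
  define g where "g = (\<lambda>u v. w u v * cmod (phase k (a u) - s (u, v) * phase k (a v)))"
  define d where "d = (\<lambda>u v. w u v * cmod (f u - s (u, v) * f v) * (cmod (f u) + cmod (f v)))"
  \<comment> \<open>The share of the edge \<open>e\<close> at threshold \<open>t\<close>: its
    rounding bound if induced, its weight if cut.\<close>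
  define h where "h e t = (if e \<subseteq> W t then edge_value g e else 0)
    + (if e \<inter> W t \<noteq> {} \<and> \<not> e \<subseteq> W t then edge_value w e else 0)" for e t
  have finV: "finite V" and finE: "finite E"
    using assms(2) finite_edges[OF assms(2)] by (auto simp: finite_simple_graph_def)
  have f_eq: "of_real (cmod (f u)) * phase k (a u) = f u" for u
    using rcis_cmod_Arg[of "f u"] assms(1) by (simp add: rcis_def phase_def a_def)
  have le1: "cmod (f u) \<le> 1" if "u \<in> V" for u
    using Max_ge[of "(\<lambda>u. cmod (f u)) ` V" "cmod (f u)"] assms(6) finV that by auto
  have pointwise: "frustration_index k E w s (W t) + boundary_weight V E w (W t) \<le> (\<Sum>e\<in>E. h e t)" for t
  proof -
    have sub: "W t \<subseteq> V"
      by (auto simp: W_def superlevel_set_def)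
    have "edge_sum (induced_edges E (W t)) g = (\<Sum>e\<in>E. if e \<subseteq> W t then edge_value g e else 0)"
      unfolding edge_sum_def induced_edges_def using finE by (rule sum.inter_filter)
    then show ?thesis
      using frustration_index_le[OF assms(1,2,4,5) sub, of a]
        boundary_weight_eq[OF assms(2,4) sub]
      by (simp add: g_def h_def sum.distrib)
  qed
  have "\<exists>J. (h e has_integral J) {0..1} \<and> J \<le> 2 * edge_value d e" if e: "e \<in> E" for e
  proof -
    \<comment> \<open>The edge values do not depend on the orientation, so \<open>v\<close> may be
      taken as the endpoint of smaller modulus.\<close>
    obtain u v where uv: "e = {u, v}" "u \<in> V" "v \<in> V" and le: "cmod (f v) \<le> cmod (f u)"
      using edge_endpointsE[OF assms(2) e] by (metis insert_commute linear)
    have edge: "{u, v} \<in> E"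
      using e uv by simp
    have w: "w u v > 0" "w u v = w v u"
      using assms(4) edge by (auto simp: edge_weight_def)
    have "s (u, v) \<in> cyclic_roots k"
      using assms(5) edge by (auto simp: signature_def oriented_edges_def)
    then have ns: "cmod (s (u, v)) = 1"
      by (rule norm_cyclic_roots)
    \<comment> \<open>The signature has modulus 1, so it can be merged into the unit vector at
      \<open>v\<close>, and the edge inequality applies without a signature.\<close>
    define Q where "Q = s (u, v) * phase k (a v)"
    have g_val: "edge_value g e = w u v * cmod (phase k (a u) - Q)"
      unfolding g_def uv Q_def by (rule edge_value_signed_difference[OF assms(4,5) edge])
    have w_val: "edge_value w e = w u v"
      unfolding uv using w by (intro edge_value_eq)
    have d_val: "edge_value d e = w u v * cmod (f u - s (u, v) * f v) * (cmod (f u) + cmod (f v))"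
      unfolding d_def uv using w signed_difference_commute[OF assms(5) edge, of f]
      by (intro edge_value_eq) (simp add: add.commute)
    have "((\<lambda>t. if sqrt t \<le> cmod (f v) then edge_value g e
        else if sqrt t \<le> cmod (f u) then edge_value w e else 0) has_integral
        (cmod (f v))\<^sup>2 * edge_value g e + ((cmod (f u))\<^sup>2 - (cmod (f v))\<^sup>2) * edge_value w e) {0..1}"
      using le le1 uv by (intro has_integral_edge_layers) auto
    then have "(h e has_integral
        (cmod (f v))\<^sup>2 * edge_value g e + ((cmod (f u))\<^sup>2 - (cmod (f v))\<^sup>2) * edge_value w e) {0..1}"
    proof (rule has_integral_eq[rotated])
      fix t :: real
      \<comment> \<open>The endpoint \<open>v\<close> leaves \<open>W t\<close> first: the edge is
        induced as long as \<open>v\<close> is in \<open>W t\<close>, and cut while only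
        \<open>u\<close> remains.\<close>
      show "(if sqrt t \<le> cmod (f v) then edge_value g e
          else if sqrt t \<le> cmod (f u) then edge_value w e else 0) = h e t"
        using le uv by (auto simp: h_def W_def superlevel_set_def)
    qed
    moreover have "(cmod (f v))\<^sup>2 * edge_value g e + ((cmod (f u))\<^sup>2 - (cmod (f v))\<^sup>2) * edge_value w e
        \<le> 2 * edge_value d e"
    proof -
      have "(cmod (f v))\<^sup>2 * cmod (phase k (a u) - Q) + ((cmod (f u))\<^sup>2 - (cmod (f v))\<^sup>2)
        \<le> 2 * (cmod (of_real (cmod (f u)) * phase k (a u) - of_real (cmod (f v)) * Q)
              * (cmod (f u) + cmod (f v)))"
        using le ns by (intro edge_layer_bound) (auto simp: Q_def norm_mult)
      also have "of_real (cmod (f v)) * Q = s (u, v) * (of_real (cmod (f v)) * phase k (a v))"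
        by (simp add: Q_def)
      finally have "(cmod (f v))\<^sup>2 * cmod (phase k (a u) - Q) + ((cmod (f u))\<^sup>2 - (cmod (f v))\<^sup>2)
        \<le> 2 * (cmod (f u - s (u, v) * f v) * (cmod (f u) + cmod (f v)))"
        unfolding f_eq .
      from mult_left_mono[OF this less_imp_le[OF w(1)]] show ?thesis
        unfolding g_val w_val d_val by (simp add: algebra_simps)
    qed
    ultimately show ?thesis by blast
  qed
  then obtain J where J: "\<And>e. e \<in> E \<Longrightarrow> (h e has_integral J e) {0..1}"
      "\<And>e. e \<in> E \<Longrightarrow> J e \<le> 2 * edge_value d e"
    by metis
  \<comment> \<open>Integrability needs its own argument, since \<open>pointwise\<close> only bounds
    the integrand from above.\<close>
  have int: "(\<lambda>t. frustration_index k E w s (W t) + boundary_weight V E w (W t)) integrable_on {0..1}"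
    unfolding W_def
    by (rule integrable_on_superlevel[OF finV, of "\<lambda>W. frustration_index k E w s W + boundary_weight V E w W"])
  have "((\<lambda>t. \<Sum>e\<in>E. h e t) has_integral sum J E) {0..1}"
    by (intro has_integral_sum finE J(1))
  then have "integral {0..1} (\<lambda>t. frustration_index k E w s (W t) + boundary_weight V E w (W t)) \<le> sum J E"
    using int pointwise by (intro has_integral_le[OF integrable_integral])
  also have "\<dots> \<le> 2 * edge_sum E d"
    unfolding edge_sum_def sum_distrib_left by (intro sum_mono J(2))
  finally show ?thesis
    using int unfolding W_def d_def by blast
qed

end
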